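(* There exists a three-generated lattice $L$ such that (i) $L$ has no atom, (ii) $L$ is $2$-distributive, and (iii) $L$ is not finitely presented.
   Context: A lattice $L$ is three-generated if it has a three-element subset $\{a_1,a_2,a_3\}$ that is contained in no proper sublattice of $L$ (a sublattice $S$ is proper if $S\neq L$). An element $a\in L$ is an atom if the principal ideal $\{x\in L: x\leq a\}$ has exactly two elements. A lattice $L$ is $2$-distributive if $$x\wedge (y_0\vee y_1\vee y_2)\leq \bigl( x\wedge (y_0\vee y_1)\bigr) \vee \bigl( x\wedge (y_0\vee y_2)\bigr) \vee \bigl( x\wedge (y_1\vee y_2)\bigr)$$ holds for all $x,y_0,y_1,y_2\in L$. A lattice $L$ is finitely presented if there are a positive integer $n$ and finitely many $n$-ary lattice terms $f_1',f_1'',\dots,f_t',f_t''$ such that $L$ is isomorphic to $\mathrm{FL}(x_1,\dots,x_n)/\Theta$, where $\mathrm{FL}(x_1,\dots,x_n)$ is the lattice freely generated by the $n$-element set $\{x_1,\dots,x_n\}$ in the variety of all lattices, $\Theta=\bigvee_{i=1}^t \mathrm{con}\bigl(f_i'(x_1,\dots,x_n),f_i''(x_1,\dots,x_n)\bigr)$, $\mathrm{con}(u,v)$ denotes the least congruence collapsing $u$ and $v$, and the join is taken in the lattice of all congruences of $\mathrm{FL}(x_1,\dots,x_n)$. *)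

theory Defs
  imports "HOL-Algebra.Complete_Lattice"
begin

text \<open>
  Lattices are the order-theoretic lattices with explicit carrier of \<open>HOL-Algebra\<close>;
  the locale \<^locale>\<open>lattice\<close> forces the \<^const>\<open>eq\<close> component of the record to be equality.
  A finitely generated lattice is countable, so existence of a three-generated lattice may be
  stated for carriers that are sets of natural numbers.
\<close>

section \<open>Generation, atoms, 2-distributivity\<close>

definition sublattice :: "'a set \<Rightarrow> ('a, 'b) gorder_scheme \<Rightarrow> bool" where
  "sublattice S L \<longleftrightarrow> S \<noteq> {} \<and> S \<subseteq> carrier L \<and>
     (\<forall>x\<in>S. \<forall>y\<in>S. x \<squnion>\<^bsub>L\<^esub> y \<in> S \<and> x \<sqinter>\<^bsub>L\<^esub> y \<in> S)"

definition three_generated :: "('a, 'b) gorder_scheme \<Rightarrow> bool" where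
  "three_generated L \<longleftrightarrow>
     (\<exists>A\<subseteq>carrier L. card A = 3 \<and> \<not> (\<exists>S. sublattice S L \<and> S \<noteq> carrier L \<and> A \<subseteq> S))"

definition atom :: "('a, 'b) gorder_scheme \<Rightarrow> 'a \<Rightarrow> bool" where
  "atom L a \<longleftrightarrow> a \<in> carrier L \<and> card {x \<in> carrier L. x \<sqsubseteq>\<^bsub>L\<^esub> a} = 2"

definition two_distributive :: "('a, 'b) gorder_scheme \<Rightarrow> bool" where
  "two_distributive L \<longleftrightarrow>
     (\<forall>x\<in>carrier L. \<forall>y0\<in>carrier L. \<forall>y1\<in>carrier L. \<forall>y2\<in>carrier L.
        x \<sqinter>\<^bsub>L\<^esub> (y0 \<squnion>\<^bsub>L\<^esub> y1 \<squnion>\<^bsub>L\<^esub> y2) \<sqsubseteq>\<^bsub>L\<^esub>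
        (x \<sqinter>\<^bsub>L\<^esub> (y0 \<squnion>\<^bsub>L\<^esub> y1)) \<squnion>\<^bsub>L\<^esub> (x \<sqinter>\<^bsub>L\<^esub> (y0 \<squnion>\<^bsub>L\<^esub> y2)) \<squnion>\<^bsub>L\<^esub> (x \<sqinter>\<^bsub>L\<^esub> (y1 \<squnion>\<^bsub>L\<^esub> y2)))"

section \<open>Lattice terms and free lattices\<close>

datatype (vars: 'v) lterm = Var 'v | Join "'v lterm" "'v lterm" | Meet "'v lterm" "'v lterm"

primrec lterm_eval :: "('a, 'b) gorder_scheme \<Rightarrow> ('v \<Rightarrow> 'a) \<Rightarrow> 'v lterm \<Rightarrow> 'a" where
  "lterm_eval L g (Var x) = g x"
| "lterm_eval L g (Join s t) = lterm_eval L g s \<squnion>\<^bsub>L\<^esub> lterm_eval L g t"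
| "lterm_eval L g (Meet s t) = lterm_eval L g s \<sqinter>\<^bsub>L\<^esub> lterm_eval L g t"

text \<open>
  The equational theory of lattices: the least congruence of the term algebra containing all
  instances of the lattice axioms (idempotency follows from absorption).
\<close>

inductive lterm_eq :: "'v lterm \<Rightarrow> 'v lterm \<Rightarrow> bool" (infix \<open>\<approx>\<^sub>L\<close> 50) where
  refl: "s \<approx>\<^sub>L s"
| sym: "s \<approx>\<^sub>L t \<Longrightarrow> t \<approx>\<^sub>L s"
| trans: "r \<approx>\<^sub>L s \<Longrightarrow> s \<approx>\<^sub>L t \<Longrightarrow> r \<approx>\<^sub>L t"
| Join_cong: "s \<approx>\<^sub>L s' \<Longrightarrow> t \<approx>\<^sub>L t' \<Longrightarrow> Join s t \<approx>\<^sub>L Join s' t'"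
| Meet_cong: "s \<approx>\<^sub>L s' \<Longrightarrow> t \<approx>\<^sub>L t' \<Longrightarrow> Meet s t \<approx>\<^sub>L Meet s' t'"
| Join_comm: "Join s t \<approx>\<^sub>L Join t s"
| Meet_comm: "Meet s t \<approx>\<^sub>L Meet t s"
| Join_assoc: "Join (Join r s) t \<approx>\<^sub>L Join r (Join s t)"
| Meet_assoc: "Meet (Meet r s) t \<approx>\<^sub>L Meet r (Meet s t)"
| Join_absorb: "Join s (Meet s t) \<approx>\<^sub>L s"
| Meet_absorb: "Meet s (Join s t) \<approx>\<^sub>L s"

definition lterm_rel :: "'v set \<Rightarrow> ('v lterm \<times> 'v lterm) set" where
  "lterm_rel X = {(s, t). vars s \<subseteq> X \<and> vars t \<subseteq> X \<and> s \<approx>\<^sub>L t}"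

text \<open>
  \<open>FL X\<close> is the lattice freely generated by \<open>X\<close>, with \<open>FL_gen X x\<close> the generator belonging to
  \<open>x\<close>; see \<open>lattice_FL\<close>, \<open>FL_generated\<close> and \<open>FL_universal\<close> below.
\<close>

definition FL :: "'v set \<Rightarrow> 'v lterm set gorder" where
  "FL X = \<lparr>carrier = {t. vars t \<subseteq> X} // lterm_rel X, eq = (=),
           le = (\<lambda>A B. \<exists>s\<in>A. \<exists>t\<in>B. Join s t \<approx>\<^sub>L t)\<rparr>"

definition FL_gen :: "'v set \<Rightarrow> 'v \<Rightarrow> 'v lterm set" where
  "FL_gen X x = lterm_rel X `` {Var x}"

section \<open>Congruences and quotients\<close>

definition lattice_congruence :: "('a, 'b) gorder_scheme \<Rightarrow> ('a \<times> 'a) set \<Rightarrow> bool" where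
  "lattice_congruence L \<theta> \<longleftrightarrow> equiv (carrier L) \<theta> \<and>
     (\<forall>(x, x')\<in>\<theta>. \<forall>(y, y')\<in>\<theta>. (x \<squnion>\<^bsub>L\<^esub> y, x' \<squnion>\<^bsub>L\<^esub> y') \<in> \<theta> \<and> (x \<sqinter>\<^bsub>L\<^esub> y, x' \<sqinter>\<^bsub>L\<^esub> y') \<in> \<theta>)"

definition Con :: "('a, 'b) gorder_scheme \<Rightarrow> ('a \<times> 'a) set gorder" where
  "Con L = \<lparr>carrier = {\<theta>. lattice_congruence L \<theta>}, eq = (=), le = (\<subseteq>)\<rparr>"

definition con :: "('a, 'b) gorder_scheme \<Rightarrow> 'a \<Rightarrow> 'a \<Rightarrow> ('a \<times> 'a) set" where
  "con L u v = \<Inter>{\<theta>. lattice_congruence L \<theta> \<and> (u, v) \<in> \<theta>}"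

text \<open>
  The order below is the one induced by the operations on representatives:
  see \<open>quotient_join\<close> and \<open>quotient_meet\<close>.
\<close>

definition quotient_lattice :: "('a, 'b) gorder_scheme \<Rightarrow> ('a \<times> 'a) set \<Rightarrow> 'a set gorder" where
  "quotient_lattice L \<theta> = \<lparr>carrier = carrier L // \<theta>, eq = (=),
     le = (\<lambda>A B. \<exists>x\<in>A. \<exists>y\<in>B. x \<sqsubseteq>\<^bsub>L\<^esub> y)\<rparr>"

definition lattice_isomorphic :: "('a, 'c) gorder_scheme \<Rightarrow> ('b, 'd) gorder_scheme \<Rightarrow> bool" where
  "lattice_isomorphic L K \<longleftrightarrow>
     (\<exists>h. bij_betw h (carrier L) (carrier K) \<and> join_pres L K h \<and> meet_pres L K h)"

section \<open>Finite presentability\<close>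

text \<open>
  The variables are the numbers below \<open>n\<close>, and \<open>R\<close> is the finite set of pairs of \<open>n\<close>-ary terms
  \<open>(f', f'')\<close>.
\<close>

definition finitely_presented :: "('a, 'b) gorder_scheme \<Rightarrow> bool" where
  "finitely_presented L \<longleftrightarrow>
     (\<exists>(n::nat) R. n > 0 \<and> finite R \<and> (\<forall>(f', f'')\<in>R. vars f' \<subseteq> {..<n} \<and> vars f'' \<subseteq> {..<n}) \<and>
        (let F = FL {..<n}; x = FL_gen {..<n};
             \<Theta> = \<Squnion>\<^bsub>Con F\<^esub> {con F (lterm_eval F x f') (lterm_eval F x f'') | f' f''. (f', f'') \<in> R}
         in lattice_isomorphic L (quotient_lattice F \<Theta>)))"

section \<open>Adequacy of the definitions\<close>

lemma lattice_of_operations: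
  fixes L :: "'a gorder"
  assumes eq: "eq L = (=)"
    and J: "\<And>x y. x \<in> carrier L \<Longrightarrow> y \<in> carrier L \<Longrightarrow> j x y \<in> carrier L"
    and M: "\<And>x y. x \<in> carrier L \<Longrightarrow> y \<in> carrier L \<Longrightarrow> m x y \<in> carrier L"
    and Jc: "\<And>x y. x \<in> carrier L \<Longrightarrow> y \<in> carrier L \<Longrightarrow> j x y = j y x"
    and Mc: "\<And>x y. x \<in> carrier L \<Longrightarrow> y \<in> carrier L \<Longrightarrow> m x y = m y x"
    and Ja: "\<And>x y z. x \<in> carrier L \<Longrightarrow> y \<in> carrier L \<Longrightarrow> z \<in> carrier L \<Longrightarrow> j (j x y) z = j x (j y z)"
    and Ma: "\<And>x y z. x \<in> carrier L \<Longrightarrow> y \<in> carrier L \<Longrightarrow> z \<in> carrier L \<Longrightarrow> m (m x y) z = m x (m y z)"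
    and Jm: "\<And>x y. x \<in> carrier L \<Longrightarrow> y \<in> carrier L \<Longrightarrow> j x (m x y) = x"
    and Mj: "\<And>x y. x \<in> carrier L \<Longrightarrow> y \<in> carrier L \<Longrightarrow> m x (j x y) = x"
    and le: "\<And>x y. x \<in> carrier L \<Longrightarrow> y \<in> carrier L \<Longrightarrow> x \<sqsubseteq>\<^bsub>L\<^esub> y \<longleftrightarrow> j x y = y"
  shows "lattice L"
    and "\<And>x y. x \<in> carrier L \<Longrightarrow> y \<in> carrier L \<Longrightarrow> x \<squnion>\<^bsub>L\<^esub> y = j x y"
    and "\<And>x y. x \<in> carrier L \<Longrightarrow> y \<in> carrier L \<Longrightarrow> x \<sqinter>\<^bsub>L\<^esub> y = m x y"
proof -
  have le': "x \<sqsubseteq>\<^bsub>L\<^esub> y \<longleftrightarrow> m x y = x" if "x \<in> carrier L" "y \<in> carrier L" for x y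
  proof
    assume "x \<sqsubseteq>\<^bsub>L\<^esub> y"
    then show "m x y = x" using that le[OF that] Mj[OF that] by simp
  next
    assume "m x y = x"
    then show "x \<sqsubseteq>\<^bsub>L\<^esub> y" using that Jm[of y x] by (simp add: le Jc[of x y] Mc[of x y])
  qed
  have idem: "j x x = x" if "x \<in> carrier L" for x
    using that by (metis Jm Mj J)
  interpret partial_order L
  proof
    show "x .=\<^bsub>L\<^esub> y \<Longrightarrow> z .=\<^bsub>L\<^esub> w \<Longrightarrow> (x \<sqsubseteq>\<^bsub>L\<^esub> z) = (y \<sqsubseteq>\<^bsub>L\<^esub> w)" for x y z w by (simp add: eq)
    show "x \<sqsubseteq>\<^bsub>L\<^esub> z" if "x \<sqsubseteq>\<^bsub>L\<^esub> y" "y \<sqsubseteq>\<^bsub>L\<^esub> z" "x \<in> carrier L" "y \<in> carrier L" "z \<in> carrier L" for x y z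
      using that by (metis le Ja)
    show "x .=\<^bsub>L\<^esub> y" if "x \<sqsubseteq>\<^bsub>L\<^esub> y" "y \<sqsubseteq>\<^bsub>L\<^esub> x" "x \<in> carrier L" "y \<in> carrier L" for x y
      using that by (metis le Jc eq)
  qed (auto simp: eq le idem)
  have lub: "least L (j x y) (Upper L {x, y})" if "x \<in> carrier L" "y \<in> carrier L" for x y
  proof (rule least_UpperI)
    have "j x (j x y) = j x y" "j y (j y x) = j y x"
      using that by (simp_all add: idem flip: Ja)
    then show "a \<sqsubseteq>\<^bsub>L\<^esub> j x y" if "a \<in> {x, y}" for a
      using that \<open>x \<in> carrier L\<close> \<open>y \<in> carrier L\<close> by (auto simp: le J Jc[of x y])
    show "j x y \<sqsubseteq>\<^bsub>L\<^esub> u" if "u \<in> Upper L {x, y}" for u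
    proof -
      have "u \<in> carrier L" "x \<sqsubseteq>\<^bsub>L\<^esub> u" "y \<sqsubseteq>\<^bsub>L\<^esub> u"
        using that \<open>x \<in> carrier L\<close> \<open>y \<in> carrier L\<close> by (auto simp: Upper_def)
      then show ?thesis
        using \<open>x \<in> carrier L\<close> \<open>y \<in> carrier L\<close> by (simp add: le J Ja)
    qed
  qed (use that J in auto)
  have idem': "m x x = x" if "x \<in> carrier L" for x
    using that by (metis Jm Mj M)
  have glb: "greatest L (m x y) (Lower L {x, y})" if "x \<in> carrier L" "y \<in> carrier L" for x y
  proof (rule greatest_LowerI)
    have "m x (m x y) = m x y" "m y (m y x) = m y x"
      using that by (simp_all add: idem' flip: Ma)
    then have "m x y \<sqsubseteq>\<^bsub>L\<^esub> x" "m x y \<sqsubseteq>\<^bsub>L\<^esub> y"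
      using that by (simp add: le' M Mc[of "m x y"], simp add: le' M Mc[of "m x y"] Mc[of x y] Mc[of "m y x"])
    then show "m x y \<sqsubseteq>\<^bsub>L\<^esub> a" if "a \<in> {x, y}" for a
      using that by blast
    show "u \<sqsubseteq>\<^bsub>L\<^esub> m x y" if "u \<in> Lower L {x, y}" for u
    proof -
      have "u \<in> carrier L" "u \<sqsubseteq>\<^bsub>L\<^esub> x" "u \<sqsubseteq>\<^bsub>L\<^esub> y"
        using that \<open>x \<in> carrier L\<close> \<open>y \<in> carrier L\<close> by (auto simp: Lower_def)
      then show ?thesis
        using \<open>x \<in> carrier L\<close> \<open>y \<in> carrier L\<close> by (simp add: le' M flip: Ma)
    qed
  qed (use that M in auto)
  show lat: "lattice L"
    by unfold_locales (use lub glb in blast)+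
  show "x \<squnion>\<^bsub>L\<^esub> y = j x y" if "x \<in> carrier L" "y \<in> carrier L" for x y
    unfolding join_def Lattice.sup_def using lub[OF that] by (rule some_equality) (use lub[OF that] least_unique in blast)
  show "x \<sqinter>\<^bsub>L\<^esub> y = m x y" if "x \<in> carrier L" "y \<in> carrier L" for x y
    unfolding meet_def Lattice.inf_def using glb[OF that] by (rule some_equality) (use glb[OF that] greatest_unique in blast)
qed

lemma lattice_absorb:
  assumes "lattice L" "x \<in> carrier L" "y \<in> carrier L"
  shows "x \<squnion>\<^bsub>L\<^esub> (x \<sqinter>\<^bsub>L\<^esub> y) = x" "x \<sqinter>\<^bsub>L\<^esub> (x \<squnion>\<^bsub>L\<^esub> y) = x"
proof -
  interpret lattice L by fact
  have "x \<sqinter>\<^bsub>L\<^esub> y \<squnion>\<^bsub>L\<^esub> x = x"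
    using assms le_iff_meet[of "x \<sqinter>\<^bsub>L\<^esub> y" x] meet_left by (metis meet_closed)
  then show "x \<squnion>\<^bsub>L\<^esub> (x \<sqinter>\<^bsub>L\<^esub> y) = x" by (simp add: join_comm)
  show "x \<sqinter>\<^bsub>L\<^esub> (x \<squnion>\<^bsub>L\<^esub> y) = x"
    using assms le_iff_join[of x "x \<squnion>\<^bsub>L\<^esub> y"] join_left by (metis join_closed)
qed

lemma equiv_lterm_rel: "equiv {t. vars t \<subseteq> X} (lterm_rel X)"
  by (rule equivI) (auto simp: lterm_rel_def refl_on_def sym_def trans_def
      intro: lterm_eq.refl lterm_eq.sym lterm_eq.trans)

definition FL_class :: "'v set \<Rightarrow> 'v lterm \<Rightarrow> 'v lterm set" where
  "FL_class X t = lterm_rel X `` {t}"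

lemma FL_class_eq_iff:
  "vars s \<subseteq> X \<Longrightarrow> vars t \<subseteq> X \<Longrightarrow> FL_class X s = FL_class X t \<longleftrightarrow> s \<approx>\<^sub>L t"
  unfolding FL_class_def
  by (subst eq_equiv_class_iff[OF equiv_lterm_rel]) (auto simp: lterm_rel_def)

lemma FL_carrier: "carrier (FL X) = FL_class X ` {t. vars t \<subseteq> X}"
  by (auto simp: FL_def FL_class_def quotient_def)

lemma FL_class_closed: "vars t \<subseteq> X \<Longrightarrow> FL_class X t \<in> carrier (FL X)"
  by (auto simp: FL_carrier)

lemma FL_class_some:
  assumes "vars t \<subseteq> X"
  shows "vars (SOME s. s \<in> FL_class X t) \<subseteq> X \<and> (SOME s. s \<in> FL_class X t) \<approx>\<^sub>L t"
proof -
  have "t \<in> FL_class X t" using assms by (auto simp: FL_class_def lterm_rel_def intro: lterm_eq.refl)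
  then have "(SOME s. s \<in> FL_class X t) \<in> FL_class X t" by (rule someI)
  then show ?thesis by (auto simp: FL_class_def lterm_rel_def intro: lterm_eq.sym)
qed

lemma FL_le:
  assumes "vars s \<subseteq> X" "vars t \<subseteq> X"
  shows "FL_class X s \<sqsubseteq>\<^bsub>FL X\<^esub> FL_class X t \<longleftrightarrow> Join s t \<approx>\<^sub>L t"
proof
  assume "FL_class X s \<sqsubseteq>\<^bsub>FL X\<^esub> FL_class X t"
  then obtain s' t' where "s \<approx>\<^sub>L s'" "t \<approx>\<^sub>L t'" "Join s' t' \<approx>\<^sub>L t'"
    by (auto simp: FL_def FL_class_def lterm_rel_def)
  then show "Join s t \<approx>\<^sub>L t"
    by (blast intro: lterm_eq.trans[OF lterm_eq.Join_cong lterm_eq.trans[OF _ lterm_eq.sym]])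
next
  assume "Join s t \<approx>\<^sub>L t"
  then show "FL_class X s \<sqsubseteq>\<^bsub>FL X\<^esub> FL_class X t"
    using assms by (auto simp: FL_def FL_class_def lterm_rel_def intro: lterm_eq.refl)
qed

theorem lattice_FL: "lattice (FL X)"
  and FL_join: "\<And>s t. vars s \<subseteq> X \<Longrightarrow> vars t \<subseteq> X \<Longrightarrow>
    FL_class X s \<squnion>\<^bsub>FL X\<^esub> FL_class X t = FL_class X (Join s t)"
  and FL_meet: "\<And>s t. vars s \<subseteq> X \<Longrightarrow> vars t \<subseteq> X \<Longrightarrow>
    FL_class X s \<sqinter>\<^bsub>FL X\<^esub> FL_class X t = FL_class X (Meet s t)"
proof -
  define r where "r A = (SOME s. s \<in> A)" for A :: "'a lterm set"
  define j where "j A B = FL_class X (Join (r A) (r B))" for A B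
  define m where "m A B = FL_class X (Meet (r A) (r B))" for A B
  have r: "vars (r (FL_class X t)) \<subseteq> X" "r (FL_class X t) \<approx>\<^sub>L t" if "vars t \<subseteq> X" for t
    using FL_class_some[OF that] by (auto simp: r_def)
  have j: "j (FL_class X s) (FL_class X t) = FL_class X (Join s t)"
    if "vars s \<subseteq> X" "vars t \<subseteq> X" for s t
    unfolding j_def using that r by (subst FL_class_eq_iff) (auto intro: lterm_eq.Join_cong)
  have m: "m (FL_class X s) (FL_class X t) = FL_class X (Meet s t)"
    if "vars s \<subseteq> X" "vars t \<subseteq> X" for s t
    unfolding m_def using that r by (subst FL_class_eq_iff) (auto intro: lterm_eq.Meet_cong)
  have eq: "eq (FL X) = (=)" by (simp add: FL_def)
  note lterm_axioms = lterm_eq.Join_comm lterm_eq.Meet_comm lterm_eq.Join_assoc lterm_eq.Meet_assoc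
    lterm_eq.Join_absorb lterm_eq.Meet_absorb
  note * = lattice_of_operations[of "FL X" j m, OF eq]
  have 1: "lattice (FL X)"
    by (rule *(1))
      (auto simp: FL_carrier j m FL_class_eq_iff FL_le intro: lterm_axioms del: equalityI)
  have 2: "\<And>A B. A \<in> carrier (FL X) \<Longrightarrow> B \<in> carrier (FL X) \<Longrightarrow> A \<squnion>\<^bsub>FL X\<^esub> B = j A B"
    by (rule *(2))
      (auto simp: FL_carrier j m FL_class_eq_iff FL_le intro: lterm_axioms del: equalityI)
  have 3: "\<And>A B. A \<in> carrier (FL X) \<Longrightarrow> B \<in> carrier (FL X) \<Longrightarrow> A \<sqinter>\<^bsub>FL X\<^esub> B = m A B"
    by (rule *(3))
      (auto simp: FL_carrier j m FL_class_eq_iff FL_le intro: lterm_axioms del: equalityI)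
  show "lattice (FL X)" by fact
  show "FL_class X s \<squnion>\<^bsub>FL X\<^esub> FL_class X t = FL_class X (Join s t)"
    if "vars s \<subseteq> X" "vars t \<subseteq> X" for s t
    using that by (simp add: 2 j FL_class_closed)
  show "FL_class X s \<sqinter>\<^bsub>FL X\<^esub> FL_class X t = FL_class X (Meet s t)"
    if "vars s \<subseteq> X" "vars t \<subseteq> X" for s t
    using that by (simp add: 3 m FL_class_closed)
qed

lemma lterm_eval_FL: "vars t \<subseteq> X \<Longrightarrow> lterm_eval (FL X) (FL_gen X) t = FL_class X t"
  by (induction t) (simp_all add: FL_join FL_meet FL_gen_def flip: FL_class_def)

theorem FL_generated: "carrier (FL X) = lterm_eval (FL X) (FL_gen X) ` {t. vars t \<subseteq> X}"
  by (auto simp: FL_carrier lterm_eval_FL)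

lemma lterm_eval_closed:
  assumes "lattice L" "g \<in> X \<rightarrow> carrier L" "vars t \<subseteq> X"
  shows "lterm_eval L g t \<in> carrier L"
proof -
  interpret lattice L by fact
  show ?thesis using assms(2,3) by (induction t) auto
qed

lemma lterm_eval_sound:
  assumes "lattice L" "s \<approx>\<^sub>L t" "range g \<subseteq> carrier L"
  shows "lterm_eval L g s = lterm_eval L g t"
proof -
  interpret lattice L by fact
  have c: "lterm_eval L g r \<in> carrier L" for r
    by (rule lterm_eval_closed[OF assms(1), of _ UNIV]) (use assms(3) in auto)
  have ja: "x \<squnion>\<^bsub>L\<^esub> y \<squnion>\<^bsub>L\<^esub> z = x \<squnion>\<^bsub>L\<^esub> (y \<squnion>\<^bsub>L\<^esub> z)"
    and ma: "x \<sqinter>\<^bsub>L\<^esub> y \<sqinter>\<^bsub>L\<^esub> z = x \<sqinter>\<^bsub>L\<^esub> (y \<sqinter>\<^bsub>L\<^esub> z)"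
    if "x \<in> carrier L" "y \<in> carrier L" "z \<in> carrier L" for x y z
    using weak_join_assoc[OF that] weak_meet_assoc[OF that] that by (simp_all add: eq_is_equal)
  show ?thesis using assms(2)
  proof induction
    case (Join_comm s t)
    show ?case by (simp add: join_comm)
  next
    case (Meet_comm s t)
    show ?case by (simp add: meet_comm)
  qed (simp_all add: c ja ma lattice_absorb[OF assms(1)])
qed

theorem FL_universal:
  fixes L :: "('a, 'b) gorder_scheme" and g :: "'v \<Rightarrow> 'a"
  assumes "lattice L" "g \<in> X \<rightarrow> carrier L"
  obtains h where "h \<in> carrier (FL X) \<rightarrow> carrier L"
    "join_pres (FL X) L h" "meet_pres (FL X) L h" "\<And>x. x \<in> X \<Longrightarrow> h (FL_gen X x) = g x"
proof (cases "X = {}")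
  case True
  have "\<not> vars t \<subseteq> {}" for t :: "'v lterm" by (induction t) auto
  then have "carrier (FL X) = {}" using True by (simp add: FL_carrier)
  then show thesis
    using that[of undefined] lattice_FL[of X] assms True by (simp add: join_pres_def meet_pres_def)
next
  case False
  then obtain x0 where x0: "x0 \<in> X" by blast
  define g' where "g' x = (if x \<in> X then g x else g x0)" for x
  have g': "range g' \<subseteq> carrier L" using assms(2) x0 by (auto simp: g'_def)
  define h where "h A = lterm_eval L g' (SOME s. s \<in> A)" for A
  have h: "h (FL_class X t) = lterm_eval L g' t" if "vars t \<subseteq> X" for t
    unfolding h_def using FL_class_some[OF that] lterm_eval_sound[OF assms(1) _ g'] by blast
  have c: "lterm_eval L g' r \<in> carrier L" for r
    by (rule lterm_eval_closed[OF assms(1), of _ UNIV]) (use g' in auto)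
  show thesis
  proof (rule that[of h])
    show "h \<in> carrier (FL X) \<rightarrow> carrier L" by (auto simp: FL_carrier h c)
    show "join_pres (FL X) L h" "meet_pres (FL X) L h"
      using assms(1) lattice_FL[of X]
      by (auto simp: join_pres_def meet_pres_def FL_carrier FL_join FL_meet h)
    show "h (FL_gen X x) = g x" if "x \<in> X" for x
      using h[of "Var x"] that by (simp add: FL_gen_def FL_class_def g'_def)
  qed
qed

lemma lattice_congruenceD:
  assumes "lattice_congruence L \<theta>"
  shows "equiv (carrier L) \<theta>"
    and "\<And>x x' y y'. (x, x') \<in> \<theta> \<Longrightarrow> (y, y') \<in> \<theta> \<Longrightarrow> (x \<squnion>\<^bsub>L\<^esub> y, x' \<squnion>\<^bsub>L\<^esub> y') \<in> \<theta>"
    and "\<And>x x' y y'. (x, x') \<in> \<theta> \<Longrightarrow> (y, y') \<in> \<theta> \<Longrightarrow> (x \<sqinter>\<^bsub>L\<^esub> y, x' \<sqinter>\<^bsub>L\<^esub> y') \<in> \<theta>"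
  using assms by (auto simp: lattice_congruence_def)

lemma lattice_congruence_top:
  assumes "lattice L"
  shows "lattice_congruence L (carrier L \<times> carrier L)"
proof -
  interpret lattice L by fact
  show ?thesis
    by (auto simp: lattice_congruence_def refl_on_def sym_def trans_def intro!: equivI)
qed

lemma lattice_congruence_Inter:
  assumes "T \<noteq> {}" "\<And>\<theta>. \<theta> \<in> T \<Longrightarrow> lattice_congruence L \<theta>"
  shows "lattice_congruence L (\<Inter>T)"
proof -
  have "equiv (carrier L) (\<Inter>T)"
  proof (rule equivI)
    show "\<Inter>T \<subseteq> carrier L \<times> carrier L"
      using assms lattice_congruenceD(1) by (fastforce simp: equiv_def)
    show "refl_on (carrier L) (\<Inter>T)"
      using assms(2)[THEN lattice_congruenceD(1)] by (auto simp: equiv_def refl_on_def)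
    show "sym (\<Inter>T)"
      using assms(2)[THEN lattice_congruenceD(1)] by (auto simp: equiv_def sym_def)
    show "trans (\<Inter>T)"
      using assms(2)[THEN lattice_congruenceD(1)] unfolding equiv_def trans_def by blast
  qed
  then show ?thesis
    using assms(2) by (fastforce simp: lattice_congruence_def)
qed

theorem con_least:
  assumes "lattice L" "u \<in> carrier L" "v \<in> carrier L"
  shows "lattice_congruence L (con L u v)" "(u, v) \<in> con L u v"
    and "\<And>\<theta>. lattice_congruence L \<theta> \<Longrightarrow> (u, v) \<in> \<theta> \<Longrightarrow> con L u v \<subseteq> \<theta>"
proof -
  have "carrier L \<times> carrier L \<in> {\<theta>. lattice_congruence L \<theta> \<and> (u, v) \<in> \<theta>}"
    using assms lattice_congruence_top by auto
  then show "lattice_congruence L (con L u v)"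
    unfolding con_def by (intro lattice_congruence_Inter) auto
qed (auto simp: con_def)

theorem Con_Sup:
  assumes "lattice L" "T \<subseteq> carrier (Con L)"
  shows "\<Squnion>\<^bsub>Con L\<^esub> T = \<Inter>{\<theta>. lattice_congruence L \<theta> \<and> \<Union>T \<subseteq> \<theta>}" (is "_ = ?S")
    and "lattice_congruence L (\<Squnion>\<^bsub>Con L\<^esub> T)"
proof -
  have "\<theta> \<subseteq> carrier L \<times> carrier L" if "\<theta> \<in> T" for \<theta>
    using assms(2) that by (auto simp: Con_def lattice_congruence_def equiv_def)
  then have "\<Union>T \<subseteq> carrier L \<times> carrier L" by blast
  then have S: "lattice_congruence L ?S"
    using lattice_congruence_top[OF assms(1)] by (intro lattice_congruence_Inter) auto
  have U: "Upper (Con L) T = {\<theta>. lattice_congruence L \<theta> \<and> \<Union>T \<subseteq> \<theta>}"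
    using assms(2) unfolding Upper_def Con_def by auto
  have "\<Union>T \<subseteq> ?S" by blast
  with S have "?S \<in> {\<theta>. lattice_congruence L \<theta> \<and> \<Union>T \<subseteq> \<theta>}" by simp
  moreover from this have "least (Con L) x (Upper (Con L) T) \<longleftrightarrow>
      x \<in> {\<theta>. lattice_congruence L \<theta> \<and> \<Union>T \<subseteq> \<theta>} \<and> x \<subseteq> ?S" for x
    unfolding U by (simp add: least_def Con_def) blast
  ultimately have "least (Con L) x (Upper (Con L) T) \<longleftrightarrow> x = ?S" for x
    by blast
  then show "\<Squnion>\<^bsub>Con L\<^esub> T = ?S" by (simp add: Lattice.sup_def)
  with S show "lattice_congruence L (\<Squnion>\<^bsub>Con L\<^esub> T)" by simp
qed

theorem lattice_quotient:
  fixes L :: "('a, 'b) gorder_scheme"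
  assumes "lattice L" "lattice_congruence L \<theta>"
  shows "lattice (quotient_lattice L \<theta>)"
    and quotient_join: "\<And>x y. x \<in> carrier L \<Longrightarrow> y \<in> carrier L \<Longrightarrow>
      \<theta> `` {x} \<squnion>\<^bsub>quotient_lattice L \<theta>\<^esub> \<theta> `` {y} = \<theta> `` {x \<squnion>\<^bsub>L\<^esub> y}"
    and quotient_meet: "\<And>x y. x \<in> carrier L \<Longrightarrow> y \<in> carrier L \<Longrightarrow>
      \<theta> `` {x} \<sqinter>\<^bsub>quotient_lattice L \<theta>\<^esub> \<theta> `` {y} = \<theta> `` {x \<sqinter>\<^bsub>L\<^esub> y}"
proof -
  interpret lattice L by fact
  note C = lattice_congruenceD[OF assms(2)]
  let ?Q = "quotient_lattice L \<theta>"
  define r where "r A = (SOME s. s \<in> A)" for A :: "'a set"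
  define j where "j A B = \<theta> `` {r A \<squnion>\<^bsub>L\<^esub> r B}" for A B
  define m where "m A B = \<theta> `` {r A \<sqinter>\<^bsub>L\<^esub> r B}" for A B
  have Q: "carrier ?Q = (\<lambda>x. \<theta> `` {x}) ` carrier L"
    by (auto simp: quotient_lattice_def quotient_def)
  have E: "\<theta> `` {x} = \<theta> `` {y} \<longleftrightarrow> (x, y) \<in> \<theta>" if "x \<in> carrier L" "y \<in> carrier L" for x y
    using eq_equiv_class_iff[OF C(1)] that by simp
  have rf: "(x, x) \<in> \<theta>" if "x \<in> carrier L" for x
    using C(1) that by (auto simp: equiv_def refl_on_def)
  have sub: "x \<in> carrier L" "y \<in> carrier L" if "(x, y) \<in> \<theta>" for x y
    using C(1) that by (auto simp: equiv_def)
  have sy: "(y, x) \<in> \<theta>" if "(x, y) \<in> \<theta>" for x y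
    using C(1) that by (auto simp: equiv_def sym_def)
  have tr: "(x, z) \<in> \<theta>" if "(x, y) \<in> \<theta>" "(y, z) \<in> \<theta>" for x y z
    using C(1) that unfolding equiv_def trans_def by blast
  have r: "(r (\<theta> `` {x}), x) \<in> \<theta>" if "x \<in> carrier L" for x
    using someI[of "\<lambda>s. s \<in> \<theta> `` {x}" x] rf[OF that] unfolding r_def by (blast intro: sy)
  have j: "j (\<theta> `` {x}) (\<theta> `` {y}) = \<theta> `` {x \<squnion>\<^bsub>L\<^esub> y}" if "x \<in> carrier L" "y \<in> carrier L" for x y
    unfolding j_def using C(2)[OF r r] that sub[OF r] by (subst E) auto
  have m: "m (\<theta> `` {x}) (\<theta> `` {y}) = \<theta> `` {x \<sqinter>\<^bsub>L\<^esub> y}" if "x \<in> carrier L" "y \<in> carrier L" for x y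
    unfolding m_def using C(3)[OF r r] that sub[OF r] by (subst E) auto
  have le: "\<theta> `` {x} \<sqsubseteq>\<^bsub>?Q\<^esub> \<theta> `` {y} \<longleftrightarrow> (x \<squnion>\<^bsub>L\<^esub> y, y) \<in> \<theta>"
    if "x \<in> carrier L" "y \<in> carrier L" for x y
  proof
    assume "\<theta> `` {x} \<sqsubseteq>\<^bsub>?Q\<^esub> \<theta> `` {y}"
    then obtain x' y' where *: "(x, x') \<in> \<theta>" "(y, y') \<in> \<theta>" "x' \<sqsubseteq>\<^bsub>L\<^esub> y'"
      by (auto simp: quotient_lattice_def)
    then have "x' \<squnion>\<^bsub>L\<^esub> y' = y'" using le_iff_meet sub by blast
    then show "(x \<squnion>\<^bsub>L\<^esub> y, y) \<in> \<theta>" using C(2)[OF *(1,2)] * sy tr by metis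
  next
    assume "(x \<squnion>\<^bsub>L\<^esub> y, y) \<in> \<theta>"
    then show "\<theta> `` {x} \<sqsubseteq>\<^bsub>?Q\<^esub> \<theta> `` {y}"
      using rf[OF that(1)] sy join_left[OF that] by (auto simp: quotient_lattice_def)
  qed
  have ja: "x \<squnion>\<^bsub>L\<^esub> y \<squnion>\<^bsub>L\<^esub> z = x \<squnion>\<^bsub>L\<^esub> (y \<squnion>\<^bsub>L\<^esub> z)"
    and ma: "x \<sqinter>\<^bsub>L\<^esub> y \<sqinter>\<^bsub>L\<^esub> z = x \<sqinter>\<^bsub>L\<^esub> (y \<sqinter>\<^bsub>L\<^esub> z)"
    if "x \<in> carrier L" "y \<in> carrier L" "z \<in> carrier L" for x y z
    using weak_join_assoc[OF that] weak_meet_assoc[OF that] that by (simp_all add: eq_is_equal)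
  have eq: "eq ?Q = (=)" by (simp add: quotient_lattice_def)
  note * = lattice_of_operations[of ?Q j m, OF eq]
  have laws:
    "\<And>A B. A \<in> carrier ?Q \<Longrightarrow> B \<in> carrier ?Q \<Longrightarrow> j A B \<in> carrier ?Q"
    "\<And>A B. A \<in> carrier ?Q \<Longrightarrow> B \<in> carrier ?Q \<Longrightarrow> m A B \<in> carrier ?Q"
    "\<And>A B. A \<in> carrier ?Q \<Longrightarrow> B \<in> carrier ?Q \<Longrightarrow> j A B = j B A"
    "\<And>A B. A \<in> carrier ?Q \<Longrightarrow> B \<in> carrier ?Q \<Longrightarrow> m A B = m B A"
    "\<And>A B D. A \<in> carrier ?Q \<Longrightarrow> B \<in> carrier ?Q \<Longrightarrow> D \<in> carrier ?Q \<Longrightarrow> j (j A B) D = j A (j B D)"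
    "\<And>A B D. A \<in> carrier ?Q \<Longrightarrow> B \<in> carrier ?Q \<Longrightarrow> D \<in> carrier ?Q \<Longrightarrow> m (m A B) D = m A (m B D)"
    "\<And>A B. A \<in> carrier ?Q \<Longrightarrow> B \<in> carrier ?Q \<Longrightarrow> j A (m A B) = A"
    "\<And>A B. A \<in> carrier ?Q \<Longrightarrow> B \<in> carrier ?Q \<Longrightarrow> m A (j A B) = A"
    "\<And>A B. A \<in> carrier ?Q \<Longrightarrow> B \<in> carrier ?Q \<Longrightarrow> A \<sqsubseteq>\<^bsub>?Q\<^esub> B \<longleftrightarrow> j A B = B"
            apply (auto simp: Q j m)[2]
          apply (auto simp: Q j m join_comm[of L])[1]
         apply (auto simp: Q j m meet_comm[of L])[1]
    by (auto simp: Q j m ja ma le E lattice_absorb[OF assms(1)] del: equalityI)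
  show "lattice ?Q" by (rule *(1)[OF laws])
  have 2: "A \<squnion>\<^bsub>?Q\<^esub> B = j A B" if "A \<in> carrier ?Q" "B \<in> carrier ?Q" for A B
    by (rule *(2)[OF laws that])
  have 3: "A \<sqinter>\<^bsub>?Q\<^esub> B = m A B" if "A \<in> carrier ?Q" "B \<in> carrier ?Q" for A B
    by (rule *(3)[OF laws that])
  show "\<theta> `` {x} \<squnion>\<^bsub>?Q\<^esub> \<theta> `` {y} = \<theta> `` {x \<squnion>\<^bsub>L\<^esub> y}" if "x \<in> carrier L" "y \<in> carrier L" for x y
    using that by (simp add: 2 Q j)
  show "\<theta> `` {x} \<sqinter>\<^bsub>?Q\<^esub> \<theta> `` {y} = \<theta> `` {x \<sqinter>\<^bsub>L\<^esub> y}" if "x \<in> carrier L" "y \<in> carrier L" for x y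
    using that by (simp add: 3 Q m)
qed

end

theory Submission
  imports Defs "HOL-Library.Countable"
begin

text \<open>
  The lattice consists of the empty set, the tails \<open>T n\<close> of \<open>\<nat>\<close>, and the tails \<open>X n\<close> of the
  residue classes modulo 3, ordered by inclusion.
  It is generated by \<open>X 0, X 1, X 2\<close>, since
  \<open>X (n + 3) = X n \<inter> (X (n + 1) \<squnion> X (n + 2))\<close>, and this descent excludes atoms. The join of three
  elements is always the join of two of them, hence 2-distributivity.

  The join-closed finite subsets \<open>{\<emptyset>, X 0, \<dots>, X (k + 1), T 0, \<dots>, T k}\<close> are lattices in the
  induced order and exhaust the lattice, and any finite part of the two operations agrees with that
  of a large such subset. If the lattice were finitely presented, some
  homomorphism into such a subset would fix the generators. It would send \<open>X (k + 2)\<close> to \<open>\<emptyset>\<close>, which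
  contradicts \<open>X k \<squnion> X (k + 2) = X k \<squnion> X (k + 1)\<close>.
\<close>

section \<open>Lattices with explicit carrier\<close>

lemma (in lattice) join_eqI:
  assumes "x \<in> carrier L" "y \<in> carrier L" "z \<in> carrier L" "x \<sqsubseteq> z" "y \<sqsubseteq> z"
    and "\<And>u. u \<in> carrier L \<Longrightarrow> x \<sqsubseteq> u \<Longrightarrow> y \<sqsubseteq> u \<Longrightarrow> z \<sqsubseteq> u"
  shows "x \<squnion> y = z"
  using assms by (intro le_antisym join_le) (auto simp: join_left join_right)

lemma (in lattice) meet_eqI:
  assumes "x \<in> carrier L" "y \<in> carrier L" "z \<in> carrier L" "z \<sqsubseteq> x" "z \<sqsubseteq> y"
    and "\<And>u. u \<in> carrier L \<Longrightarrow> u \<sqsubseteq> x \<Longrightarrow> u \<sqsubseteq> y \<Longrightarrow> u \<sqsubseteq> z"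
  shows "x \<sqinter> y = z"
  using assms by (intro le_antisym meet_le) (auto simp: meet_left meet_right)

text \<open>If the triple join is already one of the three pairwise joins, the left side of the
  inequality is literally one of the three joinands on the right.\<close>

lemma two_distributive_of_breadth_two:
  assumes "lattice L"
    and br: "\<And>y0 y1 y2. y0 \<in> carrier L \<Longrightarrow> y1 \<in> carrier L \<Longrightarrow> y2 \<in> carrier L \<Longrightarrow>
      y0 \<squnion>\<^bsub>L\<^esub> y1 \<squnion>\<^bsub>L\<^esub> y2 \<in> {y0 \<squnion>\<^bsub>L\<^esub> y1, y0 \<squnion>\<^bsub>L\<^esub> y2, y1 \<squnion>\<^bsub>L\<^esub> y2}"
  shows "two_distributive L"
  unfolding two_distributive_def
proof (intro ballI)
  interpret lattice L by fact
  fix x y0 y1 y2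
  assume c: "x \<in> carrier L" "y0 \<in> carrier L" "y1 \<in> carrier L" "y2 \<in> carrier L"
  let ?a = "x \<sqinter>\<^bsub>L\<^esub> (y0 \<squnion>\<^bsub>L\<^esub> y1)" and ?b = "x \<sqinter>\<^bsub>L\<^esub> (y0 \<squnion>\<^bsub>L\<^esub> y2)" and ?c = "x \<sqinter>\<^bsub>L\<^esub> (y1 \<squnion>\<^bsub>L\<^esub> y2)"
  have ab: "?a \<sqsubseteq>\<^bsub>L\<^esub> ?a \<squnion>\<^bsub>L\<^esub> ?b" "?b \<sqsubseteq>\<^bsub>L\<^esub> ?a \<squnion>\<^bsub>L\<^esub> ?b"
    and abc: "?a \<squnion>\<^bsub>L\<^esub> ?b \<sqsubseteq>\<^bsub>L\<^esub> ?a \<squnion>\<^bsub>L\<^esub> ?b \<squnion>\<^bsub>L\<^esub> ?c" "?c \<sqsubseteq>\<^bsub>L\<^esub> ?a \<squnion>\<^bsub>L\<^esub> ?b \<squnion>\<^bsub>L\<^esub> ?c"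
    using c by (simp_all add: join_left join_right)
  have "?a \<sqsubseteq>\<^bsub>L\<^esub> ?a \<squnion>\<^bsub>L\<^esub> ?b \<squnion>\<^bsub>L\<^esub> ?c" "?b \<sqsubseteq>\<^bsub>L\<^esub> ?a \<squnion>\<^bsub>L\<^esub> ?b \<squnion>\<^bsub>L\<^esub> ?c"
    using ab abc(1) c by (auto intro: le_trans)
  then show "x \<sqinter>\<^bsub>L\<^esub> (y0 \<squnion>\<^bsub>L\<^esub> y1 \<squnion>\<^bsub>L\<^esub> y2) \<sqsubseteq>\<^bsub>L\<^esub> ?a \<squnion>\<^bsub>L\<^esub> ?b \<squnion>\<^bsub>L\<^esub> ?c"
    using br[OF c(2-4)] abc(2) by auto
qed

section \<open>Finitely presented lattices\<close>

lemma lattice_congruence_kernel: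
  assumes "lattice L" "lattice K" "h \<in> carrier L \<rightarrow> carrier K"
    and "join_pres L K h" "meet_pres L K h"
  shows "lattice_congruence L {(x, y). x \<in> carrier L \<and> y \<in> carrier L \<and> h x = h y}"
proof -
  interpret lattice L by fact
  have "h (x \<squnion>\<^bsub>L\<^esub> y) = h x \<squnion>\<^bsub>K\<^esub> h y" "h (x \<sqinter>\<^bsub>L\<^esub> y) = h x \<sqinter>\<^bsub>K\<^esub> h y"
    if "x \<in> carrier L" "y \<in> carrier L" for x y
    using assms(4,5) that by (auto simp: join_pres_def meet_pres_def)
  then show ?thesis
    unfolding lattice_congruence_def
    by (auto intro!: equivI simp: refl_on_def sym_def trans_def)
qed

lemma lterm_eval_hom:
  assumes "lattice L" "h \<in> carrier L \<rightarrow> carrier K" "join_pres L K h" "meet_pres L K h"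
    and "g \<in> X \<rightarrow> carrier L" "vars t \<subseteq> X"
  shows "h (lterm_eval L g t) = lterm_eval K (h \<circ> g) t"
  using assms(6)
proof (induction t)
  case (Join s t)
  then show ?case
    using assms(3) lterm_eval_closed[OF assms(1,5)] by (simp add: join_pres_def)
next
  case (Meet s t)
  then show ?case
    using assms(4) lterm_eval_closed[OF assms(1,5)] by (simp add: meet_pres_def)
qed simp

text \<open>Eliminates the free lattice and its quotient once and for all, leaving generators,
  relations and the universal property. The latter holds because the kernel of the homomorphism from
  the free lattice to \<open>K\<close> is a congruence containing the relations, hence contains
  \<open>\<Theta>\<close>. The type of \<open>K\<close> is fixed for each application through
  \<open>'c\<close> and \<open>'d\<close>.\<close>

lemma finitely_presentedE:
  fixes L :: "('a, 'b) gorder_scheme"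
  assumes "lattice L" "finitely_presented L"
  obtains n g R where "g \<in> {..<n} \<rightarrow> carrier L" "finite R"
    "\<And>s t. (s, t) \<in> R \<Longrightarrow> vars s \<subseteq> {..<n} \<and> vars t \<subseteq> {..<n}"
    "\<And>s t. (s, t) \<in> R \<Longrightarrow> lterm_eval L g s = lterm_eval L g t"
    "\<And>a. a \<in> carrier L \<Longrightarrow> \<exists>t. vars t \<subseteq> {..<n :: nat} \<and> lterm_eval L g t = a"
    "\<And>(K :: ('c, 'd) gorder_scheme) g' s t. lattice K \<Longrightarrow> g' \<in> {..<n} \<rightarrow> carrier K \<Longrightarrow>
       \<forall>(u, v)\<in>R. lterm_eval K g' u = lterm_eval K g' v \<Longrightarrow>
       vars s \<subseteq> {..<n} \<Longrightarrow> vars t \<subseteq> {..<n} \<Longrightarrow>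
       lterm_eval L g s = lterm_eval L g t \<Longrightarrow> lterm_eval K g' s = lterm_eval K g' t"
proof -
  obtain n :: nat and R where R: "finite R"
      "\<And>s t. (s, t) \<in> R \<Longrightarrow> vars s \<subseteq> {..<n} \<and> vars t \<subseteq> {..<n}"
    and iso: "lattice_isomorphic L (quotient_lattice (FL {..<n}) (\<Squnion>\<^bsub>Con (FL {..<n})\<^esub>
      {con (FL {..<n}) (lterm_eval (FL {..<n}) (FL_gen {..<n}) s) (lterm_eval (FL {..<n}) (FL_gen {..<n}) t) | s t. (s, t) \<in> R}))"
    using assms(2) unfolding finitely_presented_def Let_def
    by (elim exE conjE) (rule that, auto)
  define F where "F = FL {..<n}"
  define T where "T = {con F (FL_class {..<n} s) (FL_class {..<n} t) | s t. (s, t) \<in> R}"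
  define \<Theta> where "\<Theta> = \<Squnion>\<^bsub>Con F\<^esub> T"
  let ?c = "FL_class {..<n}"
  have F: "lattice F" unfolding F_def by (rule lattice_FL)
  have cF: "?c t \<in> carrier F" if "vars t \<subseteq> {..<n}" for t
    using that unfolding F_def by (rule FL_class_closed)
  have T: "T = {con F (lterm_eval F (FL_gen {..<n}) s) (lterm_eval F (FL_gen {..<n}) t) | s t. (s, t) \<in> R}"
    unfolding T_def F_def using R(2) lterm_eval_FL by (metis (no_types, lifting))
  have iso: "lattice_isomorphic L (quotient_lattice F \<Theta>)"
    using iso unfolding \<Theta>_def T F_def .
  have TC: "T \<subseteq> carrier (Con F)"
    using con_least(1)[OF F] cF R(2) unfolding T_def by (fastforce simp: Con_def)
  note \<Theta> = Con_Sup[OF F TC, folded \<Theta>_def]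
  note \<Theta>_equiv = lattice_congruenceD(1)[OF \<Theta>(2)]
  obtain h where h: "bij_betw h (carrier L) (carrier (quotient_lattice F \<Theta>))"
      "join_pres L (quotient_lattice F \<Theta>) h" "meet_pres L (quotient_lattice F \<Theta>) h"
    using iso unfolding lattice_isomorphic_def by blast
  have Q: "carrier (quotient_lattice F \<Theta>) = (\<lambda>t. \<Theta> `` {?c t}) ` {t. vars t \<subseteq> {..<n}}"
    by (auto simp: quotient_lattice_def quotient_def F_def FL_carrier)
  \<comment> \<open>The generators of \<open>L\<close> are the preimages, under the isomorphism
    \<open>h\<close>, of the classes of the variables.\<close>
  define g where "g i = inv_into (carrier L) h (\<Theta> `` {?c (Var i)})" for i
  have g: "g i \<in> carrier L" "h (g i) = \<Theta> `` {?c (Var i)}" if "i < n" for i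
  proof -
    have "\<Theta> `` {?c (Var i)} \<in> h ` carrier L"
      using bij_betw_imp_surj_on[OF h(1)] that unfolding Q by auto
    then show "g i \<in> carrier L" "h (g i) = \<Theta> `` {?c (Var i)}"
      unfolding g_def by (rule inv_into_into, rule f_inv_into_f)
  qed
  then have gL: "g \<in> {..<n} \<rightarrow> carrier L" by auto
  have ev: "h (lterm_eval L g t) = \<Theta> `` {?c t}" if "vars t \<subseteq> {..<n}" for t
  proof -
    have hL: "h \<in> carrier L \<rightarrow> carrier (quotient_lattice F \<Theta>)"
      using h(1) by (auto simp: bij_betw_def)
    have "lterm_eval (quotient_lattice F \<Theta>) (h \<circ> g) t = \<Theta> `` {?c t}"
      using that
    proof (induction t)
      case (Join s t)
      then show ?case
        using quotient_join[OF F \<Theta>(2)] cF by (simp add: F_def FL_join)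
    next
      case (Meet s t)
      then show ?case
        using quotient_meet[OF F \<Theta>(2)] cF by (simp add: F_def FL_meet)
    qed (simp add: g)
    then show ?thesis
      using lterm_eval_hom[OF assms(1) hL h(2,3) gL that] by simp
  qed
  \<comment> \<open>Since \<open>h\<close> is injective, the term equations valid in
    \<open>L\<close> at \<open>g\<close> are exactly the pairs in \<open>\<Theta>\<close>.\<close>
  have inj: "lterm_eval L g s = lterm_eval L g t \<longleftrightarrow> (?c s, ?c t) \<in> \<Theta>"
    if "vars s \<subseteq> {..<n}" "vars t \<subseteq> {..<n}" for s t
  proof -
    have "lterm_eval L g s = lterm_eval L g t \<longleftrightarrow> h (lterm_eval L g s) = h (lterm_eval L g t)"
      using lterm_eval_closed[OF assms(1) gL] that bij_betw_imp_inj_on[OF h(1)]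
      by (auto dest: inj_onD)
    also have "\<dots> \<longleftrightarrow> (?c s, ?c t) \<in> \<Theta>"
      unfolding ev[OF that(1)] ev[OF that(2)]
      by (rule eq_equiv_class_iff[OF \<Theta>_equiv cF[OF that(1)] cF[OF that(2)]])
    finally show ?thesis .
  qed
  have "(?c s, ?c t) \<in> \<Theta>" if "(s, t) \<in> R" for s t
  proof -
    have "con F (?c s) (?c t) \<subseteq> \<Theta>" using that unfolding \<Theta>(1) T_def by blast
    then show ?thesis using con_least(2)[OF F] cF R(2)[OF that] by blast
  qed
  then have rel: "lterm_eval L g s = lterm_eval L g t" if "(s, t) \<in> R" for s t
    using inj R(2)[OF that] that by blast
  have surj: "\<exists>t. vars t \<subseteq> {..<n} \<and> lterm_eval L g t = a" if "a \<in> carrier L" for a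
  proof -
    obtain t where t: "vars t \<subseteq> {..<n}" "h a = \<Theta> `` {?c t}"
      using bij_betw_apply[OF h(1) \<open>a \<in> carrier L\<close>] unfolding Q by auto
    have "lterm_eval L g t = a"
      using bij_betw_imp_inj_on[OF h(1)] ev[OF t(1)] t(2) that
        lterm_eval_closed[OF assms(1) gL t(1)] by (metis inj_onD)
    with t(1) show ?thesis by blast
  qed
  have univ: "lterm_eval K g' s = lterm_eval K g' t"
    if K: "lattice K" "g' \<in> {..<n} \<rightarrow> carrier K"
      and rel: "\<forall>(u, v)\<in>R. lterm_eval K g' u = lterm_eval K g' v"
      and st: "vars s \<subseteq> {..<n}" "vars t \<subseteq> {..<n}" "lterm_eval L g s = lterm_eval L g t"
    for K :: "('c, 'd) gorder_scheme" and g' s t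
  proof -
    obtain f where f: "f \<in> carrier F \<rightarrow> carrier K" "join_pres F K f" "meet_pres F K f"
        "\<And>i. i < n \<Longrightarrow> f (FL_gen {..<n} i) = g' i"
      using FL_universal[OF K] unfolding F_def by (metis lessThan_iff)
    have gen: "FL_gen {..<n} \<in> {..<n} \<rightarrow> carrier F"
      using cF[of "Var _"] by (auto simp: FL_gen_def FL_class_def)
    have fev: "f (?c u) = lterm_eval K g' u" if "vars u \<subseteq> {..<n}" for u
    proof -
      have "f (?c u) = lterm_eval K (f \<circ> FL_gen {..<n}) u"
        using lterm_eval_hom[OF F f(1-3) gen that] lterm_eval_FL[OF that] by (simp add: F_def)
      also have "\<dots> = lterm_eval K g' u"
        using that by (induction u) (auto simp: f(4))
      finally show ?thesis .
    qed
    let ?k = "{(x, y). x \<in> carrier F \<and> y \<in> carrier F \<and> f x = f y}"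
    have k: "lattice_congruence F ?k"
      by (rule lattice_congruence_kernel[OF F K(1) f(1-3)])
    have "con F (?c u) (?c v) \<subseteq> ?k" if "(u, v) \<in> R" for u v
    proof -
      have uv: "vars u \<subseteq> {..<n}" "vars v \<subseteq> {..<n}" using R(2)[OF that] by simp_all
      then have "(?c u, ?c v) \<in> ?k" using rel that cF fev by auto
      then show ?thesis by (rule con_least(3)[OF F cF[OF uv(1)] cF[OF uv(2)] k])
    qed
    then have "\<Union>T \<subseteq> ?k" unfolding T_def by blast
    then have "\<Theta> \<subseteq> ?k" unfolding \<Theta>(1) using k by blast
    then have "f (?c s) = f (?c t)" using inj st by blast
    then show ?thesis using fev st by simp
  qed
  show thesis
    by (rule that[OF gL R rel surj univ])
qed

text \<open>
  Only finitely many values of subterms occur in a presentation, so they lie in some \<open>S k\<close> together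
  with the results of the operations, on which the operations of \<open>L\<close> and of \<open>S k\<close> agree.
\<close>

lemma finitely_presented_partial_retraction:
  fixes S :: "nat \<Rightarrow> 'a set"
  assumes L: "lattice L" "finitely_presented L"
    and S: "mono S" "(\<Union>k. S k) = carrier L"
    and N: "\<And>k. lattice (L\<lparr>carrier := S k\<rparr>)"
    and A: "finite A" "A \<subseteq> carrier L"
  obtains k h where "A \<subseteq> S k" "h \<in> carrier L \<rightarrow> S k" "join_pres L (L\<lparr>carrier := S k\<rparr>) h"
    "meet_pres L (L\<lparr>carrier := S k\<rparr>) h" "\<And>a. a \<in> A \<Longrightarrow> h a = a"
\<comment> \<open>The universal property is applied to the stages, which differ from
  \<open>L\<close> only in their carrier and so have the same type.\<close>
proof (rule finitely_presentedE[OF L, where ?'c = 'a and ?'d = 'b])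
  let ?N = "\<lambda>k. L\<lparr>carrier := S k\<rparr>"
  interpret lattice L by fact
  fix n :: nat and g R
  assume g: "g \<in> {..<n} \<rightarrow> carrier L"
    and R: "finite R" "\<And>s t. (s, t) \<in> R \<Longrightarrow> vars s \<subseteq> {..<n} \<and> vars t \<subseteq> {..<n}"
      "\<And>s t. (s, t) \<in> R \<Longrightarrow> lterm_eval L g s = lterm_eval L g t"
    and surj: "\<And>a. a \<in> carrier L \<Longrightarrow> \<exists>t. vars t \<subseteq> {..<n} \<and> lterm_eval L g t = a"
    and univ: "\<And>(K :: ('a, 'b) gorder_scheme) g' s t. lattice K \<Longrightarrow> g' \<in> {..<n} \<rightarrow> carrier K \<Longrightarrow>
       \<forall>(u, v)\<in>R. lterm_eval K g' u = lterm_eval K g' v \<Longrightarrow>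
       vars s \<subseteq> {..<n} \<Longrightarrow> vars t \<subseteq> {..<n} \<Longrightarrow>
       lterm_eval L g s = lterm_eval L g t \<Longrightarrow> lterm_eval K g' s = lterm_eval K g' t"
  have SL: "S k \<subseteq> carrier L" for k unfolding S(2)[symmetric] by (rule UN_upper) simp
  \<comment> \<open>By monotonicity membership persists once it holds. Phrasing every requirement as
    "eventually" allows finitely many of them to be combined without explicit bounds on
    \<open>k\<close>.\<close>
  have ev_S: "\<forall>\<^sub>F k in sequentially. a \<in> S k" if "a \<in> carrier L" for a
  proof -
    obtain k0 where "a \<in> S k0" using \<open>a \<in> carrier L\<close> unfolding S(2)[symmetric] by (rule UN_E)
    then show ?thesis
      using monoD[OF S(1)] by (intro eventually_sequentiallyI[of k0]) blast
  qed
  \<comment> \<open>A stage need not be a sublattice of \<open>L\<close>: its operations are only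
    those of the induced order. They agree with the operations of \<open>L\<close> whenever the
    result in \<open>L\<close> stays inside the stage.\<close>
  have joinN: "x \<squnion>\<^bsub>?N k\<^esub> y = x \<squnion>\<^bsub>L\<^esub> y"
    if "x \<in> S k" "y \<in> S k" "x \<squnion>\<^bsub>L\<^esub> y \<in> S k" for x y k
    using that subsetD[OF SL[of k]] by (intro lattice.join_eqI[OF N]) (auto intro: join_left join_right join_le)
  have meetN: "x \<sqinter>\<^bsub>?N k\<^esub> y = x \<sqinter>\<^bsub>L\<^esub> y"
    if "x \<in> S k" "y \<in> S k" "x \<sqinter>\<^bsub>L\<^esub> y \<in> S k" for x y k
    using that subsetD[OF SL[of k]] by (intro lattice.meet_eqI[OF N]) (auto intro: meet_left meet_right meet_le)
  have ev: "\<forall>\<^sub>F k in sequentially. lterm_eval L g t \<in> S k \<and> lterm_eval (?N k) g t = lterm_eval L g t"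
    if "vars t \<subseteq> {..<n}" for t
    using that
  proof (induction t)
    case (Var i)
    then show ?case using ev_S g by auto
  next
    case (Join s t)
    from Join.prems have "\<forall>\<^sub>F k in sequentially. lterm_eval L g (Join s t) \<in> S k"
      by (intro ev_S lterm_eval_closed[OF L(1) g])
    moreover have "\<forall>\<^sub>F k in sequentially. lterm_eval L g s \<in> S k \<and> lterm_eval (?N k) g s = lterm_eval L g s"
      "\<forall>\<^sub>F k in sequentially. lterm_eval L g t \<in> S k \<and> lterm_eval (?N k) g t = lterm_eval L g t"
      using Join by simp_all
    ultimately show ?case by eventually_elim (simp add: joinN)
  next
    case (Meet s t)
    from Meet.prems have "\<forall>\<^sub>F k in sequentially. lterm_eval L g (Meet s t) \<in> S k"
      by (intro ev_S lterm_eval_closed[OF L(1) g])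
    moreover have "\<forall>\<^sub>F k in sequentially. lterm_eval L g s \<in> S k \<and> lterm_eval (?N k) g s = lterm_eval L g s"
      "\<forall>\<^sub>F k in sequentially. lterm_eval L g t \<in> S k \<and> lterm_eval (?N k) g t = lterm_eval L g t"
      using Meet by simp_all
    ultimately show ?case by eventually_elim (simp add: meetN)
  qed
  obtain v where v: "vars (v a) \<subseteq> {..<n}" "lterm_eval L g (v a) = a" if "a \<in> carrier L" for a
    using surj by metis
  have "\<forall>\<^sub>F k in sequentially. (\<forall>i\<in>{..<n}. g i \<in> S k) \<and>
      (\<forall>(s, t)\<in>R. lterm_eval (?N k) g s = lterm_eval (?N k) g t) \<and>
      (\<forall>a\<in>A. a \<in> S k \<and> lterm_eval (?N k) g (v a) = a)"
  proof (intro eventually_conj eventually_ball_finite ballI)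
    fix i assume "i \<in> {..<n}"
    then show "\<forall>\<^sub>F k in sequentially. g i \<in> S k" using g ev_S by auto
  next
    fix p assume "p \<in> R"
    then obtain s t where p: "p = (s, t)" "(s, t) \<in> R" by (cases p) auto
    have "\<forall>\<^sub>F k in sequentially. lterm_eval (?N k) g s = lterm_eval (?N k) g t"
      using ev[of s] ev[of t] R(2)[OF p(2)] R(3)[OF p(2)] by (auto elim: eventually_elim2)
    then show "\<forall>\<^sub>F k in sequentially. case p of (s, t) \<Rightarrow> lterm_eval (?N k) g s = lterm_eval (?N k) g t"
      by (simp add: p(1))
  next
    fix a assume "a \<in> A"
    then have a: "a \<in> carrier L" using A(2) by blast
    show "\<forall>\<^sub>F k in sequentially. a \<in> S k" by (rule ev_S[OF a])
    show "\<forall>\<^sub>F k in sequentially. lterm_eval (?N k) g (v a) = a"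
      using ev[OF v(1)[OF a]] by eventually_elim (simp add: v(2)[OF a])
  qed (use R(1) A(1) in auto)
  then obtain k where k: "\<forall>i\<in>{..<n}. g i \<in> S k"
      "\<forall>(s, t)\<in>R. lterm_eval (?N k) g s = lterm_eval (?N k) g t"
      "\<forall>a\<in>A. a \<in> S k \<and> lterm_eval (?N k) g (v a) = a"
    using eventually_happens' sequentially_bot by fastforce
  have gN: "g \<in> {..<n} \<rightarrow> carrier (?N k)" using k(1) by simp
  \<comment> \<open>The choice of the representing term \<open>v a\<close> is immaterial: by
    \<open>univ\<close>, terms with equal values in \<open>L\<close> have equal values in the stage,
    because the relations hold there. Comparing \<open>v\<close> of a join or meet with the join or
    meet of the terms then makes \<open>h\<close> a homomorphism.\<close>
  define h where "h a = lterm_eval (?N k) g (v a)" for a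
  have h: "h (lterm_eval L g t) = lterm_eval (?N k) g t" if "vars t \<subseteq> {..<n}" for t
    unfolding h_def
    using k(2) that v lterm_eval_closed[OF L(1) g that]
    by (intro univ[OF N gN]) auto
  show thesis
  proof (rule that[of k h])
    show "h \<in> carrier L \<rightarrow> S k"
      using lterm_eval_closed[OF N gN] v(1) by (auto simp: h_def)
    show "join_pres L (?N k) h"
      unfolding join_pres_def
    proof (intro conjI ballI L(1) N)
      fix x y assume "x \<in> carrier L" "y \<in> carrier L"
      then show "h (x \<squnion>\<^bsub>L\<^esub> y) = h x \<squnion>\<^bsub>?N k\<^esub> h y"
        using h[of "Join (v x) (v y)"] h[of "v x"] h[of "v y"] v by simp
    qed
    show "meet_pres L (?N k) h"
      unfolding meet_pres_def
    proof (intro conjI ballI L(1) N)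
      fix x y assume "x \<in> carrier L" "y \<in> carrier L"
      then show "h (x \<sqinter>\<^bsub>L\<^esub> y) = h x \<sqinter>\<^bsub>?N k\<^esub> h y"
        using h[of "Meet (v x) (v y)"] h[of "v x"] h[of "v y"] v by simp
    qed
  qed (use k(3) in \<open>auto simp: h_def\<close>)
qed

section \<open>Tails of residue classes modulo 3\<close>

text \<open>Codes for sets of numbers: \<open>Zero\<close> is the empty set, \<open>X n\<close> is
  the set of all numbers that are at least \<open>n\<close> and congruent to \<open>n\<close> modulo
  3, and \<open>T n\<close> is \<open>{n..}\<close>. Inclusion then becomes the arithmetic condition
  \<open>below\<close>.\<close>

datatype node = Zero | X nat | T nat

instance node :: countable
  by countable_datatype

fun below :: "node \<Rightarrow> node \<Rightarrow> bool" where
  "below Zero _ \<longleftrightarrow> True"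
| "below _ Zero \<longleftrightarrow> False"
| "below (X m) (X n) \<longleftrightarrow> n \<le> m \<and> m mod 3 = n mod 3"
| "below (X m) (T n) \<longleftrightarrow> n \<le> m"
| "below (T m) (X n) \<longleftrightarrow> False"
| "below (T m) (T n) \<longleftrightarrow> n \<le> m"

text \<open>Not the union in general: two tails from different residue classes have no common upper
  bound of the form \<open>X i\<close>, so their join is the full tail from the smaller
  start.\<close>

fun jn :: "node \<Rightarrow> node \<Rightarrow> node" where
  "jn Zero v = v"
| "jn u Zero = u"
| "jn (X m) (X n) = (if m mod 3 = n mod 3 then X (min m n) else T (min m n))"
| "jn (X m) (T n) = T (min m n)"
| "jn (T m) (X n) = T (min m n)"
| "jn (T m) (T n) = T (min m n)"

text \<open>
  The least number that is congruent to \<open>m\<close> and not below \<open>m\<close> and \<open>n\<close> is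
  \<open>m + 3 * ((n - m + 2) div 3)\<close>; for \<open>n < m\<close> the truncated subtraction yields \<open>m\<close>, as it should.
\<close>

fun mt :: "node \<Rightarrow> node \<Rightarrow> node" where
  "mt Zero v = Zero"
| "mt u Zero = Zero"
| "mt (X m) (X n) = (if m mod 3 = n mod 3 then X (max m n) else Zero)"
| "mt (X m) (T n) = X (m + 3 * ((n - m + 2) div 3))"
| "mt (T m) (X n) = X (n + 3 * ((m - n + 2) div 3))"
| "mt (T m) (T n) = T (max m n)"

lemma below_refl: "below u u"
  by (cases u) auto

lemma below_trans: "below u v \<Longrightarrow> below v w \<Longrightarrow> below u w"
  by (cases u; cases v; cases w) auto

lemma below_antisym: "below u v \<Longrightarrow> below v u \<Longrightarrow> u = v"
  by (cases u; cases v) auto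

lemma below_jn: "below u (jn u v)" "below v (jn u v)"
  by (cases u; cases v; auto simp: min_def)+

lemma jn_below: "below u w \<Longrightarrow> below v w \<Longrightarrow> below (jn u v) w"
  by (cases u; cases v; cases w) (auto simp: min_def)

lemma mt_below: "below (mt u v) u" "below (mt u v) v"
  by (cases u; cases v; auto simp: max_def; presburger)+

text \<open>Minimality of the number used in \<open>mt (X m) (T n)\<close>. With
  \<open>c = m + 3 * d\<close> one has \<open>n - m \<le> 3 * d\<close>, and
  \<open>(3 * d + 2) div 3\<close> rounds down to \<open>d\<close>.\<close>

lemma least_congruent_ge:
  fixes c m n :: nat
  assumes "m \<le> c" "n \<le> c" "c mod 3 = m mod 3"
  shows "m + 3 * ((n - m + 2) div 3) \<le> c"
proof -
  obtain d where d: "c = m + 3 * d" using mod_eq_nat1E[OF assms(3,1)] .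
  then have "(n - m + 2) div 3 \<le> (3 * d + 2) div 3" using assms(2) by (intro div_le_mono) simp
  then show ?thesis using d by simp
qed

lemma below_mt: "below w u \<Longrightarrow> below w v \<Longrightarrow> below w (mt u v)"
  by (cases u; cases v; cases w) (auto simp: least_congruent_ge[simplified] max_def)

text \<open>Among the nonzero arguments choose one of least index. If the triple join is some
  \<open>X i\<close>, or the chosen argument is a \<open>T\<close>, this argument with any other
  suffices. Otherwise it is an \<open>X\<close>, and it suffices to pair it with an argument that is
  a \<open>T\<close> or lies in another residue class.\<close>

lemma jn_breadth_two: "jn (jn u v) w \<in> {jn u v, jn u w, jn v w}"
  by (cases u; cases v; cases w) (auto simp: min_def)

section \<open>Finite join-closed stages\<close>

text \<open>The \<open>X\<close> run one index further than the \<open>T\<close>: two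
  \<open>X\<close> from different classes have distinct indices up to \<open>k + 1\<close>, so the
  smaller is at most \<open>k\<close> and their join stays inside. Meets may leave the stage: for
  \<open>k \<ge> 1\<close>, \<open>X (k - 1)\<close> and \<open>T k\<close> meet in
  \<open>X (k + 2)\<close>.\<close>

definition initial_nodes :: "nat \<Rightarrow> node set" where
  "initial_nodes k = insert Zero (X ` {..Suc k} \<union> T ` {..k})"

lemma X_mem_initial_nodes [simp]: "X n \<in> initial_nodes k \<longleftrightarrow> n \<le> Suc k"
  and T_mem_initial_nodes [simp]: "T n \<in> initial_nodes k \<longleftrightarrow> n \<le> k"
  and Zero_mem_initial_nodes [simp]: "Zero \<in> initial_nodes k"
  by (auto simp: initial_nodes_def)

lemma mono_initial_nodes: "mono initial_nodes"
  by (rule monoI) (auto simp: initial_nodes_def)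

lemma Union_initial_nodes: "(\<Union>k. initial_nodes k) = UNIV"
proof -
  have "u \<in> initial_nodes (case u of Zero \<Rightarrow> 0 | X n \<Rightarrow> n | T n \<Rightarrow> n)" for u
    by (cases u) auto
  then show ?thesis by blast
qed

lemma jn_mem_initial_nodes: "u \<in> initial_nodes k \<Longrightarrow> v \<in> initial_nodes k \<Longrightarrow> jn u v \<in> initial_nodes k"
  by (cases u; cases v) (auto simp: min_def le_Suc_eq)

text \<open>A meet can leave the stage only as some \<open>X n\<close> with
  \<open>n > k + 1\<close>. Every nonzero node below it is an \<open>X\<close> of index at least
  \<open>n\<close>, hence also outside, so the meet within the stage is \<open>Zero\<close>.\<close>

lemma below_mt_eq_Zero:
  assumes "u \<in> initial_nodes k" "v \<in> initial_nodes k" "mt u v \<notin> initial_nodes k"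
    and "w \<in> initial_nodes k" "below w u" "below w v"
  shows "w = Zero"
proof -
  obtain n where n: "mt u v = X n" "n > Suc k"
    using assms(1-3) by (cases u; cases v) (auto simp: max_def split: if_splits)
  have "below w (X n)" using below_mt[OF assms(5,6)] n(1) by simp
  then show ?thesis using assms(4) n(2) by (cases w) auto
qed

section \<open>Transport to carriers of natural numbers\<close>

definition node_order :: "node set \<Rightarrow> nat gorder" where
  "node_order S = \<lparr>carrier = to_nat ` S, eq = (=), le = (\<lambda>m n. below (from_nat m) (from_nat n))\<rparr>"

lemma node_order_simps [simp]:
  "carrier (node_order S) = to_nat ` S"
  "eq (node_order S) = (=)"
  "to_nat u \<sqsubseteq>\<^bsub>node_order S\<^esub> to_nat v \<longleftrightarrow> below u v"
  by (simp_all add: node_order_def)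

text \<open>Covers both the whole lattice, where the condition on meets is vacuous, and the stages,
  where a meet that leaves \<open>S\<close> is replaced by \<open>Zero\<close>.\<close>

lemma lattice_node_order:
  assumes Z: "Zero \<in> S" and J: "\<And>u v. u \<in> S \<Longrightarrow> v \<in> S \<Longrightarrow> jn u v \<in> S"
    and M: "\<And>u v w. u \<in> S \<Longrightarrow> v \<in> S \<Longrightarrow> mt u v \<notin> S \<Longrightarrow>
      w \<in> S \<Longrightarrow> below w u \<Longrightarrow> below w v \<Longrightarrow> w = Zero"
  shows "lattice (node_order S)"
    and "\<And>u v. u \<in> S \<Longrightarrow> v \<in> S \<Longrightarrow> to_nat u \<squnion>\<^bsub>node_order S\<^esub> to_nat v = to_nat (jn u v)"
    and "\<And>u v. u \<in> S \<Longrightarrow> v \<in> S \<Longrightarrow>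
      to_nat u \<sqinter>\<^bsub>node_order S\<^esub> to_nat v = to_nat (if mt u v \<in> S then mt u v else Zero)"
proof -
  have po: "partial_order (node_order S)"
    by unfold_locales (auto intro: below_refl below_trans below_antisym)
  interpret partial_order "node_order S" by (rule po)
  have M': "below w (if mt u v \<in> S then mt u v else Zero)"
    if "u \<in> S" "v \<in> S" "w \<in> S" "below w u" "below w v" for u v w
    using M[OF that(1,2) _ that(3-5)] below_mt[OF that(4,5)] by (auto intro: below_refl)
  have Mb: "below (if mt u v \<in> S then mt u v else Zero) u"
    "below (if mt u v \<in> S then mt u v else Zero) v" for u v
    by (simp_all add: mt_below)
  have MS: "(if mt u v \<in> S then mt u v else Zero) \<in> S" for u v
    using Z by simp
  show lat: "lattice (node_order S)"
  proof (intro lattice.intro upper_semilattice.intro lower_semilattice.intro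
      upper_semilattice_axioms.intro lower_semilattice_axioms.intro po)
    fix x y assume "x \<in> carrier (node_order S)" "y \<in> carrier (node_order S)"
    then obtain u v :: node where uv: "x = to_nat u" "y = to_nat v" "u \<in> S" "v \<in> S" by auto
    have "least (node_order S) (to_nat (jn u v)) (Upper (node_order S) {x, y})"
      using uv(3,4) J by (intro least_UpperI) (auto simp: uv(1,2) Upper_def all_conj_distrib below_jn jn_below)
    then show "\<exists>s. least (node_order S) s (Upper (node_order S) {x, y})" ..
    have "greatest (node_order S) (to_nat (if mt u v \<in> S then mt u v else Zero)) (Lower (node_order S) {x, y})"
      using uv(3,4) M' Mb MS
      by (intro greatest_LowerI) (auto simp: uv(1,2) Lower_def all_conj_distrib split del: if_split)
    then show "\<exists>s. greatest (node_order S) s (Lower (node_order S) {x, y})" ..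
  qed
  fix u v assume uv: "u \<in> S" "v \<in> S"
  show "to_nat u \<squnion>\<^bsub>node_order S\<^esub> to_nat v = to_nat (jn u v)"
    using uv J by (intro lattice.join_eqI[OF lat]) (auto simp: below_jn jn_below)
  show "to_nat u \<sqinter>\<^bsub>node_order S\<^esub> to_nat v = to_nat (if mt u v \<in> S then mt u v else Zero)"
    using uv M' Mb MS by (intro lattice.meet_eqI[OF lat]) (auto split del: if_split)
qed

lemmas lattice_nodes = lattice_node_order[of UNIV, simplified]
lemmas lattice_initial_nodes =
  lattice_node_order[OF Zero_mem_initial_nodes jn_mem_initial_nodes below_mt_eq_Zero]

section \<open>Generation, atoms and 2-distributivity\<close>

text \<open>The inner join is \<open>T (n + 1)\<close>, and the first number from
  \<open>n + 1\<close> on that is congruent to \<open>n\<close> is \<open>n + 3\<close>.\<close>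

lemma X_add_3: "mt (X n) (jn (X (Suc n)) (X (Suc (Suc n)))) = X (n + 3)"
proof -
  have "Suc n mod 3 \<noteq> Suc (Suc n) mod 3" by presburger
  then show ?thesis by simp
qed

lemma jn_X_X: "m mod 3 \<noteq> n mod 3 \<Longrightarrow> jn (X m) (X n) = T (min m n)"
  by simp

text \<open>\<open>X_add_3\<close> yields every \<open>X n\<close> from its three predecessors. Then
  \<open>T n\<close> is the join of \<open>X n\<close> and \<open>X (n + 1)\<close>, and
  \<open>Zero\<close> is the meet of \<open>X 0\<close> and \<open>X 1\<close>.\<close>

lemma generated_nodes:
  assumes "X 0 \<in> S" "X 1 \<in> S" "X 2 \<in> S"
    and J: "\<And>u v. u \<in> S \<Longrightarrow> v \<in> S \<Longrightarrow> jn u v \<in> S"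
    and M: "\<And>u v. u \<in> S \<Longrightarrow> v \<in> S \<Longrightarrow> mt u v \<in> S"
  shows "u \<in> S"
proof -
  have X: "X n \<in> S" for n
  proof (induction n rule: less_induct)
    case (less n)
    consider "n = 0" | "n = 1" | "n = 2" | m where "n = m + 3"
      by (cases "n < 3") (use le_Suc_ex[of 3 n] in \<open>auto simp: add.commute less_Suc_eq numeral_eq_Suc\<close>)
    then show ?case
    proof cases
      case 4
      then show ?thesis
        using M[OF less J[OF less less], of m "m + 1" "m + 2"] by (simp add: X_add_3 del: mt.simps jn.simps)
    qed (use assms in auto)
  qed
  have "T n \<in> S" for n
  proof -
    have "n mod 3 \<noteq> Suc n mod 3" by presburger
    then show ?thesis using J[OF X X, of n "Suc n"] by (simp add: min_def)
  qed
  moreover have "Zero \<in> S"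
    using M[OF X X, of 0 1] by simp
  ultimately show ?thesis using X by (cases u) auto
qed

lemma three_generated_nodes: "three_generated (node_order UNIV)"
  unfolding three_generated_def
proof (intro exI conjI notI)
  let ?A = "to_nat ` {X 0, X 1, X 2}"
  show "?A \<subseteq> carrier (node_order UNIV)" by auto
  show "card ?A = 3" by (subst card_image) auto
  assume "\<exists>S. sublattice S (node_order UNIV) \<and> S \<noteq> carrier (node_order UNIV) \<and> ?A \<subseteq> S"
  then obtain S where S: "sublattice S (node_order UNIV)" "S \<noteq> range (to_nat :: node \<Rightarrow> nat)" "?A \<subseteq> S"
    unfolding node_order_simps by blast
  have closed: "to_nat (jn u v) \<in> S \<and> to_nat (mt u v) \<in> S" if "to_nat u \<in> S" "to_nat v \<in> S" for u v :: node
    unfolding lattice_nodes(2,3)[symmetric] using S(1) that by (simp add: sublattice_def)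
  have "u \<in> {u. to_nat u \<in> S}" for u :: node
    by (rule generated_nodes) (use S(3) closed in auto)
  then show False using S(1,2) by (auto simp: sublattice_def)
qed

text \<open>The ideal of \<open>Zero\<close> has one element, and any other ideal has at least
  three, since \<open>X (n + 3)\<close> lies below \<open>X n\<close> and \<open>X n\<close> below
  \<open>T n\<close>. Finiteness is extracted from cardinality 2 first, because \<open>card\<close>
  is 0 on infinite sets.\<close>

lemma no_atom_nodes: "\<not> atom (node_order UNIV) a"
proof
  assume a: "atom (node_order UNIV) a"
  then obtain u :: node where u: "a = to_nat u" by (auto simp: atom_def)
  have "{x \<in> range (to_nat :: node \<Rightarrow> nat). x \<sqsubseteq>\<^bsub>node_order UNIV\<^esub> a} = to_nat ` {v. below v u}"
    using u by auto
  then have c: "card {v. below v u} = 2"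
    using a by (simp add: atom_def card_image)
  then have fin: "finite {v. below v u}" by (intro card_ge_0_finite) simp
  show False
  proof (cases u)
    case Zero
    then have "{v. below v u} = {Zero}" by (auto elim: below.elims)
    with c show False by simp
  next
    case (X n)
    then have "{Zero, X n, X (n + 3)} \<subseteq> {v. below v u}" by auto
    from card_mono[OF fin this] c show False by simp
  next
    case (T n)
    then have "{Zero, X n, T n} \<subseteq> {v. below v u}" by auto
    from card_mono[OF fin this] c show False by simp
  qed
qed

lemma two_distributive_nodes: "two_distributive (node_order UNIV)"
proof (rule two_distributive_of_breadth_two[OF lattice_nodes(1)])
  fix x y z
  assume "x \<in> carrier (node_order UNIV)" "y \<in> carrier (node_order UNIV)" "z \<in> carrier (node_order UNIV)"
  then obtain u v w :: node where "x = to_nat u" "y = to_nat v" "z = to_nat w" by auto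
  then show "x \<squnion>\<^bsub>node_order UNIV\<^esub> y \<squnion>\<^bsub>node_order UNIV\<^esub> z \<in>
      {x \<squnion>\<^bsub>node_order UNIV\<^esub> y, x \<squnion>\<^bsub>node_order UNIV\<^esub> z, y \<squnion>\<^bsub>node_order UNIV\<^esub> z}"
    using jn_breadth_two[of u v w] by (simp add: lattice_nodes(2))
qed

section \<open>Failure of finite presentability\<close>

text \<open>The map fixes every \<open>X n\<close> of the stage but sends \<open>X (k + 2)\<close>
  to \<open>Zero\<close>. Writing \<open>T k\<close> as the join of \<open>X k\<close> with
  \<open>X (k + 1)\<close> or with \<open>X (k + 2)\<close> gives it two different images.\<close>

lemma no_initial_retraction:
  assumes "k \<ge> 1" and f: "f (X 0) = X 0" "f (X 1) = X 1" "f (X 2) = X 2"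
    and J: "\<And>u v. f (jn u v) = jn (f u) (f v)"
    and M: "\<And>u v. f (mt u v) = (if mt (f u) (f v) \<in> initial_nodes k then mt (f u) (f v) else Zero)"
  shows False
proof -
  \<comment> \<open>\<open>X (n + 3)\<close> belongs to the stage iff
    \<open>n + 3 \<le> k + 1\<close>; otherwise the stage meet is \<open>Zero\<close>.\<close>
  have step: "f (X (n + 3)) = (if n + 2 \<le> k then X (n + 3) else Zero)"
    if "f (X n) = X n" "f (X (n + 1)) = X (n + 1)" "f (X (n + 2)) = X (n + 2)" for n
    using M[of "X n" "jn (X (n + 1)) (X (n + 2))"] that
    by (simp add: J X_add_3 del: mt.simps jn.simps)
  have X: "n \<le> Suc k \<Longrightarrow> f (X n) = X n" for n
  proof (induction n rule: less_induct)
    case (less n)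
    consider "n = 0" | "n = 1" | "n = 2" | m where "n = m + 3"
      by (cases "n < 3") (use le_Suc_ex[of 3 n] in \<open>auto simp: add.commute less_Suc_eq numeral_eq_Suc\<close>)
    then show ?case
    proof cases
      case 4
      then show ?thesis using step[of m] less by auto
    qed (use f in auto)
  qed
  \<comment> \<open>With \<open>k = m + 1\<close>, the first missing node \<open>X (k + 2)\<close>
    is \<open>X (m + 3)\<close>, and its three predecessors lie in the stage, hence are
    fixed.\<close>
  obtain m where m: "k = m + 1" using assms(1) by (metis add.commute le_add_diff_inverse)
  have ne: "k mod 3 \<noteq> (k + 1) mod 3" "k mod 3 \<noteq> (k + 2) mod 3" by presburger+
  have "f (X (k + 2)) = Zero"
    using step[of m] X[of m] X[of "m + 1"] X[of "m + 2"] by (simp add: m eval_nat_numeral)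
  then have "f (T k) = X k"
    using J[of "X k" "X (k + 2)"] X[of k] ne(2) by (simp add: jn_X_X min_def)
  moreover have "f (T k) = T k"
    using J[of "X k" "X (k + 1)"] X[of k] X[of "k + 1"] ne(1) by (simp add: jn_X_X min_def)
  ultimately show False by simp
qed

lemma not_finitely_presented_nodes: "\<not> finitely_presented (node_order UNIV)"
proof
  let ?L = "node_order UNIV" and ?S = "\<lambda>k. to_nat ` initial_nodes k"
  assume fp: "finitely_presented ?L"
  \<comment> \<open>Only the carrier of \<open>node_order\<close> depends on the set of nodes, so a
    stage is a carrier update of the whole lattice.\<close>
  have N: "?L\<lparr>carrier := ?S k\<rparr> = node_order (initial_nodes k)" for k
    by (simp add: node_order_def)
  have S: "mono ?S" "(\<Union>k. ?S k) = carrier ?L"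
    using mono_initial_nodes Union_initial_nodes by (auto simp: mono_def simp flip: image_UN)
  obtain k h where k: "to_nat ` {X 0, X 1, X 2} \<subseteq> ?S k" and h: "h \<in> carrier ?L \<rightarrow> ?S k"
      "join_pres ?L (node_order (initial_nodes k)) h" "meet_pres ?L (node_order (initial_nodes k)) h"
    and fix_h: "\<And>a. a \<in> to_nat ` {X 0, X 1, X 2} \<Longrightarrow> h a = a"
    by (rule finitely_presented_partial_retraction[OF lattice_nodes(1) fp S,
          of "to_nat ` {X 0, X 1, X 2}", unfolded N])
      (auto simp: lattice_initial_nodes(1))
  define f where "f u = (from_nat (h (to_nat u)) :: node)" for u :: node
  have f: "f u \<in> initial_nodes k" "h (to_nat u) = to_nat (f u)" for u
  proof -
    have "h (to_nat u) \<in> ?S k" using h(1) by auto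
    then show "f u \<in> initial_nodes k" "h (to_nat u) = to_nat (f u)" by (auto simp: f_def)
  qed
  show False
  proof (rule no_initial_retraction)
    \<comment> \<open>The stage contains \<open>X 2\<close>, so
      \<open>2 \<le> k + 1\<close>.\<close>
    show "k \<ge> 1" using k by auto
    show "f (X 0) = X 0" "f (X 1) = X 1" "f (X 2) = X 2"
      using fix_h by (auto simp: f_def)
    fix u v :: node
    have "h (to_nat u \<squnion>\<^bsub>?L\<^esub> to_nat v) = h (to_nat u) \<squnion>\<^bsub>node_order (initial_nodes k)\<^esub> h (to_nat v)"
      using h(2) by (simp add: join_pres_def)
    then show "f (jn u v) = jn (f u) (f v)"
      by (simp add: f lattice_nodes(2) lattice_initial_nodes(2))
    have "h (to_nat u \<sqinter>\<^bsub>?L\<^esub> to_nat v) = h (to_nat u) \<sqinter>\<^bsub>node_order (initial_nodes k)\<^esub> h (to_nat v)"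
      using h(3) by (simp add: meet_pres_def)
    then show "f (mt u v) = (if mt (f u) (f v) \<in> initial_nodes k then mt (f u) (f v) else Zero)"
      by (simp add: f lattice_nodes(3) lattice_initial_nodes(3) split del: if_split)
  qed
qed

theorem theorem1p1:
  "\<exists>L :: nat gorder. lattice L \<and> three_generated L \<and>
     (\<not> (\<exists>a. atom L a)) \<and> two_distributive L \<and> \<not> finitely_presented L"
  using lattice_nodes(1) three_generated_nodes no_atom_nodes two_distributive_nodes
    not_finitely_presented_nodes by blast

end
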